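(* Let $m,n\ge 1$ be integers and let a signed mass pattern on the patch $\mathbb{P}=[0,m]\times[0,n]$ be given, i.e., arbitrary real numbers $V(R_{ij})$ for $1\le i\le m$, $1\le j\le n$, where $R_{ij}=[i-1,i]\times[j-1,j]$ for all integers $i,j$. (a) There exist integers $h^-\le 0$, $v^-\le 0$, $h^+\ge m$ and $v^+\ge n$ such that $h^+-h^-=v^+-v^-=:N$, so that the big square $\mathbb{G}=\{(x,y)\mid h^-\le x\le h^+,\ v^-\le y\le v^+\}$ consists of $N^2$ small squares $R_{ij}$ with side length $1$; (b) moreover, there exists a spread of masses, i.e., real numbers $V(R_{ij})$ for $h^-+1\le i\le h^+$ and $v^-+1\le j\le v^+$, such that \[ \sum_{k=v^-+1}^{v^+}V(R_{ik})=\sum_{k=h^-+1}^{h^+}V(R_{kj})=:\mu\quad\text{for all } i \text{ and } j, \] and the masses of the squares in the patch $\mathbb{P}$ are equal to the masses prescribed by the signed mass pattern; (c) in addition, these integers and masses are such that if we divide the sides of the big square $\mathbb{G}$ by $N$, move its southwest corner to the origin, and divide all the masses by $N\mu$ (where $\mu\neq 0$), we get a mass distribution of some discrete quasi-copula.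
   Context: A bivariate quasi-copula is a function $A\colon[0,1]^2\to[0,1]$ such that $A(u,1)=u=A(1,u)$ for all $u\in[0,1]$, $A$ is increasing (non-decreasing) in each variable, and $|A(\mathbf{v})-A(\mathbf{u})|\le|v_1-u_1|+|v_2-u_2|$ for all $\mathbf{u},\mathbf{v}\in[0,1]^2$. A discrete quasi-copula on a finite mesh $\Delta\subseteq[0,1]^2$ is the restriction of a quasi-copula to $\Delta$; here $\Delta=\{0,\frac1N,\ldots,1\}^2$. The mass distribution of a discrete quasi-copula $D$ on $\{0,\frac1N,\ldots,1\}^2$ is the array of volumes $D(\frac pN,\frac qN)-D(\frac{p-1}N,\frac qN)-D(\frac pN,\frac{q-1}N)+D(\frac{p-1}N,\frac{q-1}N)$, $p,q\in\{1,\dots,N\}$, of the mesh squares $[\frac{p-1}N,\frac pN]\times[\frac{q-1}N,\frac qN]$. Thus (c) says that there is a discrete quasi-copula $D$ on this mesh whose volume of the $(p,q)$-th mesh square equals $V(R_{h^-+p,\,v^-+q})/(N\mu)$ for all $p,q\in\{1,\dots,N\}$. *)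

theory Defs
  imports Complex_Main "HOL-Library.FuncSet"
begin

definition quasi_copula :: "(real \<times> real \<Rightarrow> real) \<Rightarrow> bool" where
  "quasi_copula A \<longleftrightarrow>
     A \<in> {0..1} \<times> {0..1} \<rightarrow> {0..1} \<and>
     (\<forall>u\<in>{0..1}. A (u, 1) = u \<and> A (1, u) = u) \<and>
     (\<forall>y\<in>{0..1}. mono_on {0..1} (\<lambda>x. A (x, y))) \<and>
     (\<forall>x\<in>{0..1}. mono_on {0..1} (\<lambda>y. A (x, y))) \<and>
     (\<forall>u\<in>{0..1} \<times> {0..1}. \<forall>v\<in>{0..1} \<times> {0..1}.
        \<bar>A v - A u\<bar> \<le> \<bar>fst v - fst u\<bar> + \<bar>snd v - snd u\<bar>)"

definition discrete_quasi_copula ::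
    "(real \<times> real) set \<Rightarrow> (real \<times> real \<Rightarrow> real) \<Rightarrow> bool" where
  "discrete_quasi_copula \<Delta> D \<longleftrightarrow>
     finite \<Delta> \<and> \<Delta> \<subseteq> {0..1} \<times> {0..1} \<and>
     (\<exists>A. quasi_copula A \<and> D = restrict A \<Delta>)"

definition uniform_mesh :: "nat \<Rightarrow> (real \<times> real) set" where
  "uniform_mesh N = (\<lambda>k. real k / real N) ` {0..N} \<times> (\<lambda>k. real k / real N) ` {0..N}"

definition mesh_volume :: "nat \<Rightarrow> (real \<times> real \<Rightarrow> real) \<Rightarrow> nat \<Rightarrow> nat \<Rightarrow> real" where
  "mesh_volume N D p q =
     D (real p / real N, real q / real N)
     - D ((real p - 1) / real N, real q / real N)
     - D (real p / real N, (real q - 1) / real N)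
     + D ((real p - 1) / real N, (real q - 1) / real N)"

text \<open>Only the entries of \<open>M\<close> with indices in \<open>{1..N}\<close> matter.\<close>

definition quasi_copula_mass_distribution :: "nat \<Rightarrow> (nat \<Rightarrow> nat \<Rightarrow> real) \<Rightarrow> bool" where
  "quasi_copula_mass_distribution N M \<longleftrightarrow>
     (\<exists>D. discrete_quasi_copula (uniform_mesh N) D \<and>
          (\<forall>p\<in>{1..N}. \<forall>q\<in>{1..N}. M p q = mesh_volume N D p q))"

text \<open>The first index is horizontal, the second vertical.\<close>

definition small_square :: "int \<Rightarrow> int \<Rightarrow> (real \<times> real) set" where
  "small_square i j =
     {real_of_int i - 1..real_of_int i} \<times> {real_of_int j - 1..real_of_int j}"

definition big_square :: "int \<Rightarrow> int \<Rightarrow> int \<Rightarrow> int \<Rightarrow> (real \<times> real) set" where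
  "big_square hm hp vm vp =
     {(x, y). real_of_int hm \<le> x \<and> x \<le> real_of_int hp \<and>
              real_of_int vm \<le> y \<and> y \<le> real_of_int vp}"

end

theory Submission
  imports Defs
begin

text \<open>
  Dividing by \<open>N * \<mu>\<close> turns the entries of the spread into increments of a function \<open>D\<close> on the
  mesh.  That \<open>D\<close> extends to a quasi-copula only needs two things: all full rows and columns have
  sum \<open>\<mu>\<close> (uniform margins), and all initial segments of rows and columns have sums in
  \<open>{0..\<mu>}\<close> (these sums are the increments of \<open>D\<close> in one variable, so this is monotonicity
  and the Lipschitz condition).  Single entries may have either sign.

  Such a spread is obtained from a \<open>K \<times> K\<close> block \<open>P\<close> with \<open>\<bar>P\<bar> \<le> B\<close>, where
  \<open>K\<close> is at least both side lengths of the patch, by placing it in the middle of a \<open>3 \<times> 3\<close>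
  array of \<open>K \<times> K\<close> blocks, so that \<open>N = 3K\<close>; constants stand for constant blocks, and a row
  consists of the entries with a common first index:
    \<^item> first row: \<open>2B, B, 0\<close>;
    \<^item> second row: \<open>B, P, 2B - P\<close>;
    \<^item> third row: \<open>0, 2B - P, B + P\<close>.
  The three blocks of each row and each column of blocks add up to \<open>3B\<close>, so \<open>\<mu> = 3KB\<close>.
  Negative entries occur only in the middle block, where each is at least \<open>-B\<close>; a row or column
  through it has \<open>K\<close> entries that are at least \<open>B\<close> on either side, so both its initial and its
  final segments have nonnegative sums (\<open>partial_sum_between_0_and_total\<close>).

  The passage from the mesh to the unit square spreads each entry uniformly over its cell
  (\<open>bilinear_extension\<close>).  A line sum of this bilinear extension is a sum of entries
  weighted by a nonincreasing sequence from \<open>{0..1}\<close>, and summation by parts bounds it by the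
  initial segment sums (\<open>weighted_sum_between\<close>).
\<close>

section \<open>Extending a mass distribution on the mesh to a quasi-copula\<close>

text \<open>The fraction of the \<open>p\<close>-th of \<open>N\<close> equal subintervals of the unit interval that lies to
  the left of \<open>x\<close>.\<close>

definition cell_fraction :: "nat \<Rightarrow> nat \<Rightarrow> real \<Rightarrow> real" where
  "cell_fraction N p x = min 1 (max 0 (real N * x - (real p - 1)))"

definition bilinear_extension :: "nat \<Rightarrow> (nat \<Rightarrow> nat \<Rightarrow> real) \<Rightarrow> real \<times> real \<Rightarrow> real" where
  "bilinear_extension N M = (\<lambda>(x, y).
     \<Sum>p\<in>{1..N}. \<Sum>q\<in>{1..N}. M p q * cell_fraction N p x * cell_fraction N q y)"

lemma cell_fraction_bounds: "0 \<le> cell_fraction N p x" "cell_fraction N p x \<le> 1"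
  by (auto simp: cell_fraction_def)

lemma cell_fraction_mono: "x \<le> y \<Longrightarrow> cell_fraction N p x \<le> cell_fraction N p y"
  using mult_left_mono[of x y "real N"] by (auto simp: cell_fraction_def)

lemma cell_fraction_antimono: "cell_fraction N (Suc p) x \<le> cell_fraction N p x"
  by (auto simp: cell_fraction_def)

lemma cell_fraction_0: "1 \<le> p \<Longrightarrow> cell_fraction N p 0 = 0"
  by (auto simp: cell_fraction_def)

lemma cell_fraction_1: "p \<le> N \<Longrightarrow> cell_fraction N p 1 = 1"
  by (auto simp: cell_fraction_def)

lemma cell_fraction_mesh_point:
  assumes "0 < N"
  shows "cell_fraction N i (real p / real N) = (if i \<le> p then 1 else 0)"
  using assms by (auto simp: cell_fraction_def)

lemma sum_cell_fraction:
  assumes "x \<in> {0..1}"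
  shows "(\<Sum>p\<in>{1..N}. cell_fraction N p x) = real N * x"
proof -
  have "0 \<le> real N * x" "real N * x \<le> real N"
    using assms by (auto simp: mult_left_le)
  moreover from this have "(\<Sum>p\<in>{1..k}. cell_fraction N p x) = min (real k) (real N * x)" for k
    by (induction k) (auto simp: cell_fraction_def)
  ultimately show ?thesis by simp
qed

text \<open>Summation by parts: with nonincreasing weights \<open>w\<close>, the weighted sum is
  \<open>w n * S n + (\<Sum>k\<in>{1..<n}. (w k - w (Suc k)) * S k)\<close> for the initial segment sums \<open>S\<close>,
  and the coefficients of the \<open>S k\<close> are nonnegative with sum \<open>w 1 \<le> 1\<close>.\<close>

lemma weighted_sum_between:
  fixes a w :: "nat \<Rightarrow> real"
  assumes prefix: "\<And>k. k \<le> n \<Longrightarrow> (\<Sum>i\<in>{1..k}. a i) \<in> {0..C}"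
    and anti: "\<And>k. w (Suc k) \<le> w k"
    and w01: "\<And>k. 0 \<le> w k" "\<And>k. w k \<le> 1"
  shows "(\<Sum>i\<in>{1..n}. a i * w i) \<in> {0..C}"
proof -
  let ?S = "\<lambda>k. \<Sum>i\<in>{1..k}. a i"
  have C: "0 \<le> C" using prefix[of 0] by simp
  \<comment> \<open>The term \<open>w k * ?S k\<close> keeps both bounds inductive: lowering the weight of \<open>?S k\<close> from
    \<open>w k\<close> to \<open>w (Suc k)\<close> costs between 0 and \<open>C * (w k - w (Suc k))\<close>.\<close>
  have "w k * ?S k \<le> (\<Sum>i\<in>{1..k}. a i * w i) \<and>
        (\<Sum>i\<in>{1..k}. a i * w i) \<le> w k * ?S k + C * (1 - w k)" if "k \<le> n" for k
    using that
  proof (induction k)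
    case 0
    show ?case using C w01 by simp
  next
    case (Suc k)
    have S: "0 \<le> ?S k" "?S k \<le> C" using prefix[of k] Suc.prems by auto
    have "0 \<le> (w k - w (Suc k)) * ?S k" "0 \<le> (w k - w (Suc k)) * (C - ?S k)"
      using S anti[of k] by auto
    then show ?case using Suc by (simp add: algebra_simps)
  qed
  moreover have "0 \<le> w n * ?S n" "w n * ?S n \<le> w n * C"
    using prefix[of n] w01[of n] by (auto intro: mult_left_mono)
  ultimately show ?thesis
    by (force simp: algebra_simps)
qed

lemma bilinear_extension_swap:
  "bilinear_extension N M (x, y) = bilinear_extension N (\<lambda>p q. M q p) (y, x)"
  unfolding bilinear_extension_def prod.case
  by (subst sum.swap) (simp add: mult_ac)

lemma bilinear_extension_by_rows:
  "bilinear_extension N M (x, y) =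
     (\<Sum>p\<in>{1..N}. cell_fraction N p x * (\<Sum>q\<in>{1..N}. M p q * cell_fraction N q y))"
  by (simp add: bilinear_extension_def sum_distrib_left mult_ac)

text \<open>The slope of the extension in its first variable, within one cell, is \<open>N\<close> times a
  weighted sum of entries, so it lies between 0 and 1.\<close>

lemma bilinear_extension_increment:
  assumes prefix: "\<And>p q. p \<in> {1..N} \<Longrightarrow> q \<le> N \<Longrightarrow> (\<Sum>j\<in>{1..q}. M p j) \<in> {0..1 / real N}"
    and "x \<in> {0..1}" "x' \<in> {0..1}" "x \<le> x'"
  shows "bilinear_extension N M (x', y) - bilinear_extension N M (x, y) \<in> {0..x' - x}"
proof -
  let ?d = "\<lambda>p. cell_fraction N p x' - cell_fraction N p x"
  let ?r = "\<lambda>p. \<Sum>q\<in>{1..N}. M p q * cell_fraction N q y"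
  have r: "?r p \<in> {0..1 / real N}" if "p \<in> {1..N}" for p
    using that
    by (intro weighted_sum_between prefix cell_fraction_antimono cell_fraction_bounds)
  have d: "0 \<le> ?d p" for p
    using cell_fraction_mono[OF \<open>x \<le> x'\<close>] by simp
  have eq: "bilinear_extension N M (x', y) - bilinear_extension N M (x, y)
            = (\<Sum>p\<in>{1..N}. ?d p * ?r p)"
    by (simp add: bilinear_extension_by_rows sum_subtractf left_diff_distrib)
  have "0 \<le> ?d p * ?r p" if "p \<in> {1..N}" for p
    using r[OF that] d by (intro mult_nonneg_nonneg) auto
  then have "0 \<le> (\<Sum>p\<in>{1..N}. ?d p * ?r p)"
    by (rule sum_nonneg)
  moreover have "(\<Sum>p\<in>{1..N}. ?d p * ?r p) \<le> (\<Sum>p\<in>{1..N}. ?d p * (1 / real N))"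
    by (intro sum_mono mult_left_mono d) (use r in auto)
  moreover have "(\<Sum>p\<in>{1..N}. ?d p * (1 / real N)) \<le> x' - x"
  proof (cases "N = 0")
    case False
    have "(\<Sum>p\<in>{1..N}. ?d p * (1 / real N)) = (real N * x' - real N * x) * (1 / real N)"
      using sum_cell_fraction[OF assms(2), of N] sum_cell_fraction[OF assms(3), of N]
      by (simp only: sum_distrib_right[symmetric] sum_subtractf)
    also have "\<dots> = x' - x" using False by (simp add: field_simps)
    finally show ?thesis by simp
  qed (use assms in simp)
  ultimately show ?thesis unfolding eq by auto
qed

lemma bilinear_extension_0_left: "bilinear_extension N M (0, y) = 0"
  by (simp add: bilinear_extension_by_rows cell_fraction_0)

lemma bilinear_extension_1_right:
  assumes "0 < N" "x \<in> {0..1}"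
    and total: "\<And>p. p \<in> {1..N} \<Longrightarrow> (\<Sum>j\<in>{1..N}. M p j) = 1 / real N"
  shows "bilinear_extension N M (x, 1) = x"
proof -
  have "bilinear_extension N M (x, 1) = (\<Sum>p\<in>{1..N}. cell_fraction N p x * (1 / real N))"
    unfolding bilinear_extension_by_rows
    by (intro sum.cong refl) (use total in \<open>simp add: cell_fraction_1\<close>)
  also have "\<dots> = real N * x * (1 / real N)"
    using sum_cell_fraction[OF assms(2), of N] by (simp only: sum_distrib_right[symmetric])
  finally show ?thesis using assms(1) by simp
qed

lemma quasi_copula_bilinear_extension:
  assumes "0 < N"
    and row_prefix: "\<And>p q. p \<in> {1..N} \<Longrightarrow> q \<le> N \<Longrightarrow> (\<Sum>j\<in>{1..q}. M p j) \<in> {0..1 / real N}"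
    and col_prefix: "\<And>p q. q \<in> {1..N} \<Longrightarrow> p \<le> N \<Longrightarrow> (\<Sum>i\<in>{1..p}. M i q) \<in> {0..1 / real N}"
    and row_total: "\<And>p. p \<in> {1..N} \<Longrightarrow> (\<Sum>j\<in>{1..N}. M p j) = 1 / real N"
    and col_total: "\<And>q. q \<in> {1..N} \<Longrightarrow> (\<Sum>i\<in>{1..N}. M i q) = 1 / real N"
  shows "quasi_copula (bilinear_extension N M)"
proof -
  let ?A = "bilinear_extension N M"
  have inc1: "?A (x', y) - ?A (x, y) \<in> {0..x' - x}"
    if "x \<in> {0..1}" "x' \<in> {0..1}" "x \<le> x'" for x x' y
    using bilinear_extension_increment[of N M] row_prefix that by blast
  have inc2: "?A (x, y') - ?A (x, y) \<in> {0..y' - y}"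
    if "y \<in> {0..1}" "y' \<in> {0..1}" "y \<le> y'" for x y y'
    using bilinear_extension_increment[of N "\<lambda>p q. M q p" y y' x] col_prefix that
    by (simp add: bilinear_extension_swap[of N M])
  have right: "?A (u, 1) = u" if "u \<in> {0..1}" for u
    using bilinear_extension_1_right[OF assms(1) that, of M] row_total by blast
  have left: "?A (1, u) = u" if "u \<in> {0..1}" for u
    using bilinear_extension_1_right[OF assms(1) that, of "\<lambda>p q. M q p"] col_total
    by (simp add: bilinear_extension_swap[of N M])
  have range: "?A (x, y) \<in> {0..1}" if "x \<in> {0..1}" "y \<in> {0..1}" for x y
    using inc1[of 0 x y] inc1[of x 1 y] left[of y] that
    by (simp add: bilinear_extension_0_left)
  have lip1: "\<bar>?A (x', y) - ?A (x, y)\<bar> \<le> \<bar>x' - x\<bar>"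
    if "x \<in> {0..1}" "x' \<in> {0..1}" for x x' y
    using inc1[of x x' y] inc1[of x' x y] that by (cases "x \<le> x'") auto
  have lip2: "\<bar>?A (x, y') - ?A (x, y)\<bar> \<le> \<bar>y' - y\<bar>"
    if "y \<in> {0..1}" "y' \<in> {0..1}" for x y y'
    using inc2[of y y' x] inc2[of y' y x] that by (cases "y \<le> y'") auto
  have lip: "\<bar>?A v - ?A u\<bar> \<le> \<bar>fst v - fst u\<bar> + \<bar>snd v - snd u\<bar>"
    if "u \<in> {0..1} \<times> {0..1}" "v \<in> {0..1} \<times> {0..1}" for u v
  proof -
    obtain x y x' y' where uv: "u = (x, y)" "v = (x', y')" by (metis surj_pair)
    have "\<bar>?A (x', y') - ?A (x, y')\<bar> \<le> \<bar>x' - x\<bar>" "\<bar>?A (x, y') - ?A (x, y)\<bar> \<le> \<bar>y' - y\<bar>"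
      using lip1[of x x' y'] lip2[of y y' x] that uv by auto
    then show ?thesis unfolding uv by simp
  qed
  show ?thesis
    unfolding quasi_copula_def
  proof (intro conjI ballI)
    show "?A \<in> {0..1} \<times> {0..1} \<rightarrow> {0..1}" using range by auto
    show "mono_on {0..1} (\<lambda>x. ?A (x, y))" for y
      using inc1 by (intro mono_onI) auto
    show "mono_on {0..1} (\<lambda>y. ?A (x, y))" for x
      using inc2 by (intro mono_onI) auto
  qed (use left right lip in blast)+
qed

text \<open>At mesh points every cell fraction is 0 or 1, and passing from \<open>(p - 1) / N\<close> to
  \<open>p / N\<close> changes that of the \<open>p\<close>-th interval only; hence the extension has the prescribed
  volumes.\<close>

lemma mesh_volume_bilinear_extension:
  assumes "p \<in> {1..N}" "q \<in> {1..N}"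
  shows "mesh_volume N (bilinear_extension N M) p q = M p q"
proof -
  have N: "0 < N" using assms by auto
  let ?\<delta> = "\<lambda>p i. cell_fraction N i (real p / real N) - cell_fraction N i ((real p - 1) / real N)"
  have \<delta>: "?\<delta> p i = (if i = p then 1 else 0)" if "1 \<le> p" for p i
    using that cell_fraction_mesh_point[OF N, of i p] cell_fraction_mesh_point[OF N, of i "p - 1"]
    by (auto simp: of_nat_diff)
  have "mesh_volume N (bilinear_extension N M) p q
        = (\<Sum>i\<in>{1..N}. \<Sum>j\<in>{1..N}. M i j * ?\<delta> p i * ?\<delta> q j)"
    unfolding mesh_volume_def bilinear_extension_def prod.case
    by (simp add: sum_subtractf[symmetric] sum.distrib[symmetric] algebra_simps)
  also have "\<dots> = (\<Sum>i\<in>{1..N}. \<Sum>j\<in>{1..N}. if j = q then if i = p then M i j else 0 else 0)"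
    using \<delta>[of p] \<delta>[of q] assms by (intro sum.cong refl) auto
  also have "\<dots> = M p q"
    using assms by simp
  finally show ?thesis .
qed

lemma mesh_volume_restrict:
  assumes "p \<in> {1..N}" "q \<in> {1..N}"
  shows "mesh_volume N (restrict A (uniform_mesh N)) p q = mesh_volume N A p q"
proof -
  have "real r / real N \<in> (\<lambda>k. real k / real N) ` {0..N}"
    and "(real r - 1) / real N \<in> (\<lambda>k. real k / real N) ` {0..N}" if "r \<in> {1..N}" for r
    using that by (auto intro!: image_eqI[of _ _ "r - 1"] simp: of_nat_diff)
  then show ?thesis
    using assms by (simp add: mesh_volume_def uniform_mesh_def)
qed

proposition quasi_copula_mass_distributionI:
  assumes "0 < N"
    and "\<And>p q. p \<in> {1..N} \<Longrightarrow> q \<le> N \<Longrightarrow> (\<Sum>j\<in>{1..q}. M p j) \<in> {0..1 / real N}"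
    and "\<And>p q. q \<in> {1..N} \<Longrightarrow> p \<le> N \<Longrightarrow> (\<Sum>i\<in>{1..p}. M i q) \<in> {0..1 / real N}"
    and "\<And>p. p \<in> {1..N} \<Longrightarrow> (\<Sum>j\<in>{1..N}. M p j) = 1 / real N"
    and "\<And>q. q \<in> {1..N} \<Longrightarrow> (\<Sum>i\<in>{1..N}. M i q) = 1 / real N"
  shows "quasi_copula_mass_distribution N M"
  unfolding quasi_copula_mass_distribution_def discrete_quasi_copula_def
proof (rule exI[of _ "restrict (bilinear_extension N M) (uniform_mesh N)"], intro conjI ballI)
  show "finite (uniform_mesh N)" by (simp add: uniform_mesh_def)
  show "uniform_mesh N \<subseteq> {0..1} \<times> {0..1}"
    using assms(1) by (auto simp: uniform_mesh_def)
  have "quasi_copula (bilinear_extension N M)"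
    by (rule quasi_copula_bilinear_extension) (use assms in blast)+
  then show "\<exists>A. quasi_copula A \<and> restrict (bilinear_extension N M) (uniform_mesh N)
      = restrict A (uniform_mesh N)" by blast
qed (simp add: mesh_volume_restrict mesh_volume_bilinear_extension)

section \<open>The spread of masses\<close>

text \<open>The \<open>3 \<times> 3\<close> array of blocks, with the middle block in rows and columns \<open>{1..K}\<close>.\<close>

definition block_spread ::
    "int \<Rightarrow> real \<Rightarrow> (int \<Rightarrow> int \<Rightarrow> real) \<Rightarrow> int \<Rightarrow> int \<Rightarrow> real" where
  "block_spread K B P i j =
     (if i \<le> 0 then (if j \<le> 0 then 2 * B else if j \<le> K then B else 0)
      else if i \<le> K then
        (if j \<le> 0 then B else if j \<le> K then P i j else 2 * B - P i (j - K))
      else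
        (if j \<le> 0 then 0 else if j \<le> K then 2 * B - P (i - K) j
         else B + P (i - K) (j - K)))"

text \<open>Reduces every claim about columns to the one about rows.\<close>

lemma block_spread_transpose: "block_spread K B P i j = block_spread K B (\<lambda>i j. P j i) j i"
  by (simp add: block_spread_def)

lemma sum_over_three_blocks:
  fixes f :: "int \<Rightarrow> real"
  assumes "0 \<le> K"
  shows "(\<Sum>k\<in>{-K+1..2*K}. f k) = (\<Sum>k\<in>{1..K}. f (k - K) + f k + f (k + K))"
proof -
  have "{-K+1..2*K} = {-K+1..0} \<union> ({1..K} \<union> {K+1..2*K})" using assms by auto
  then have "sum f {-K+1..2*K} = sum f {-K+1..0} + sum f ({1..K} \<union> {K+1..2*K})"
    using assms by (simp only:) (rule sum.union_disjoint, auto)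
  also have "sum f ({1..K} \<union> {K+1..2*K}) = sum f {1..K} + sum f {K+1..2*K}"
    by (rule sum.union_disjoint) auto
  finally have "sum f {-K+1..2*K} = sum f {-K+1..0} + (sum f {1..K} + sum f {K+1..2*K})" .
  moreover have "sum f {-K+1..0} = (\<Sum>k\<in>{1..K}. f (k - K))"
    by (rule sum.reindex_bij_witness[of _ "\<lambda>k. k - K" "\<lambda>k. k + K"]) auto
  moreover have "sum f {K+1..2*K} = (\<Sum>k\<in>{1..K}. f (k + K))"
    by (rule sum.reindex_bij_witness[of _ "\<lambda>k. k + K" "\<lambda>k. k - K"]) auto
  ultimately show ?thesis by (simp add: sum.distrib)
qed

lemma block_spread_row_total:
  assumes "0 \<le> K"
  shows "(\<Sum>k\<in>{-K+1..2*K}. block_spread K B P i k) = 3 * real_of_int K * B"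
proof -
  have "(\<Sum>k\<in>{-K+1..2*K}. block_spread K B P i k) = (\<Sum>k\<in>{1..K}. 3 * B)"
    unfolding sum_over_three_blocks[OF assms]
    by (intro sum.cong refl) (auto simp: block_spread_def)
  then show ?thesis using assms by simp
qed

text \<open>The first block contributes at least \<open>K * c\<close>, which compensates any part of the middle
  block.\<close>

lemma partial_sum_nonneg:
  fixes a :: "int \<Rightarrow> real"
  assumes "0 \<le> K" "0 \<le> c" "Q \<le> 2 * K"
    and first: "\<And>k. k \<in> {-K+1..0} \<Longrightarrow> c \<le> a k"
    and middle: "\<And>k. k \<in> {1..K} \<Longrightarrow> - c \<le> a k"
    and last: "\<And>k. k \<in> {K+1..2*K} \<Longrightarrow> c \<le> a k"
  shows "0 \<le> (\<Sum>k\<in>{-K+1..Q}. a k)"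
proof (cases "Q \<le> 0")
  case True
  then show ?thesis using first assms(2) by (intro sum_nonneg) (force intro: order_trans)
next
  case False
  let ?R = "min Q K"
  have split: "{-K+1..Q} = {-K+1..0} \<union> ({1..?R} \<union> {K+1..Q})" using False assms by auto
  have sum_eq: "sum a {-K+1..Q} = sum a {-K+1..0} + (sum a {1..?R} + sum a {K+1..Q})"
    unfolding split by (subst sum.union_disjoint; auto simp: sum.union_disjoint)
  have "(\<Sum>k\<in>{-K+1..0}. c) \<le> sum a {-K+1..0}" using first by (intro sum_mono) auto
  moreover have "(\<Sum>k\<in>{1..?R}. - c) \<le> sum a {1..?R}" using middle by (intro sum_mono) auto
  moreover have "0 \<le> sum a {K+1..Q}"
    using last assms by (intro sum_nonneg) (force intro: order_trans)
  moreover have "real_of_int ?R * c \<le> real_of_int K * c"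
    using assms(2) by (intro mult_right_mono) auto
  moreover have "(\<Sum>k\<in>{-K+1..0}. c) = real_of_int K * c" 
    "(\<Sum>k\<in>{1..?R}. - c) = - (real_of_int ?R * c)"
    using False assms(1) by (auto simp: min_def)
  ultimately show ?thesis unfolding sum_eq by linarith
qed

text \<open>The hypotheses are invariant under reversing the row, so final segments have nonnegative
  sums too; this is the upper bound.  With \<open>c = 0\<close> it covers rows without negative entries.\<close>

lemma partial_sum_between_0_and_total:
  fixes a :: "int \<Rightarrow> real"
  assumes "0 \<le> K" "0 \<le> c" "- K \<le> Q" "Q \<le> 2 * K"
    and first: "\<And>k. k \<in> {-K+1..0} \<Longrightarrow> c \<le> a k"
    and middle: "\<And>k. k \<in> {1..K} \<Longrightarrow> - c \<le> a k"
    and last: "\<And>k. k \<in> {K+1..2*K} \<Longrightarrow> c \<le> a k"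
  shows "(\<Sum>k\<in>{-K+1..Q}. a k) \<in> {0..(\<Sum>k\<in>{-K+1..2*K}. a k)}"
proof -
  have "{-K+1..2*K} = {-K+1..Q} \<union> {Q+1..2*K}" using assms by auto
  then have "sum a {-K+1..2*K} = sum a {-K+1..Q} + sum a {Q+1..2*K}"
    by (simp add: sum.union_disjoint)
  moreover have "sum a {Q+1..2*K} = (\<Sum>k\<in>{-K+1..K-Q}. a (K + 1 - k))"
    by (rule sum.reindex_bij_witness[of _ "\<lambda>k. K + 1 - k" "\<lambda>k. K + 1 - k"]) auto
  moreover have "0 \<le> (\<Sum>k\<in>{-K+1..K-Q}. a (K + 1 - k))"
    using assms by (intro partial_sum_nonneg[where c = c]) auto
  moreover have "0 \<le> sum a {-K+1..Q}"
    using assms by (intro partial_sum_nonneg[where c = c]) auto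
  ultimately show ?thesis by simp
qed

lemma block_spread_row_prefix:
  assumes "0 \<le> K" "i \<le> 2 * K" "- K \<le> Q" "Q \<le> 2 * K"
    and bound: "\<And>i j. i \<in> {1..K} \<Longrightarrow> j \<in> {1..K} \<Longrightarrow> \<bar>P i j\<bar> \<le> B" and "0 \<le> B"
  shows "(\<Sum>k\<in>{-K+1..Q}. block_spread K B P i k) \<in> {0..3 * real_of_int K * B}"
proof -
  let ?c = "if i \<in> {1..K} then B else 0"
  have P: "- B \<le> P i j" "P i j \<le> B" if "i \<in> {1..K}" "j \<in> {1..K}" for i j
    using bound[OF that] by auto
  have "(\<Sum>k\<in>{-K+1..Q}. block_spread K B P i k)
        \<in> {0..(\<Sum>k\<in>{-K+1..2*K}. block_spread K B P i k)}"
  proof (rule partial_sum_between_0_and_total[where c = ?c])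
    show "?c \<le> block_spread K B P i k" if "k \<in> {-K+1..0}" for k
      using that \<open>0 \<le> B\<close> by (auto simp: block_spread_def)
    show "- ?c \<le> block_spread K B P i k" if "k \<in> {1..K}" for k
      using that assms(2) \<open>0 \<le> B\<close> P[of i k] P[of "i - K" k] by (auto simp: block_spread_def)
    show "?c \<le> block_spread K B P i k" if "k \<in> {K+1..2*K}" for k
      using that assms(2) \<open>0 \<le> B\<close> P[of i "k - K"] P[of "i - K" "k - K"]
      by (auto simp: block_spread_def)
  qed (use assms in auto)
  then show ?thesis using block_spread_row_total[OF assms(1)] by simp
qed

lemma sum_shift_int:
  fixes f :: "int \<Rightarrow> real"
  shows "(\<Sum>k\<in>{1..q}. f (a + int k)) = (\<Sum>k\<in>{a+1..a + int q}. f k)"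
  by (rule sum.reindex_bij_witness[of _ "\<lambda>k. nat (k - a)" "\<lambda>k. a + int k"]) auto

proposition block_spread_mass_distribution:
  assumes K: "1 \<le> K" and B: "0 < B"
    and bound: "\<And>i j. i \<in> {1..K} \<Longrightarrow> j \<in> {1..K} \<Longrightarrow> \<bar>P i j\<bar> \<le> B"
    and N: "int N = 3 * K" and \<mu>: "\<mu> = 3 * real_of_int K * B"
  shows "quasi_copula_mass_distribution N
           (\<lambda>p q. block_spread K B P (- K + int p) (- K + int q) / (real N * \<mu>))"
proof -
  have \<mu>0: "0 < \<mu>" using K B \<mu> by simp
  have N0: "0 < N" using K N by simp
  have end_eq: "- K + int N = 2 * K" using N by simp
  have scale: "x / (real N * \<mu>) \<in> {0..1 / real N}" if "x \<in> {0..\<mu>}" for x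
    using that \<mu>0 N0 by (auto simp: field_simps)
  have prefix: "(\<Sum>k\<in>{1..q}. block_spread K B P' (- K + int p) (- K + int k) / (real N * \<mu>))
      \<in> {0..1 / real N}"
    if "p \<in> {1..N}" "q \<le> N"
      "\<And>i j. i \<in> {1..K} \<Longrightarrow> j \<in> {1..K} \<Longrightarrow> \<bar>P' i j\<bar> \<le> B" for P' p q
    unfolding sum_divide_distrib[symmetric] sum_shift_int
    using that K B N \<mu> by (intro scale) (simp only: \<mu>, intro block_spread_row_prefix, auto)
  have total: "(\<Sum>k\<in>{1..N}. block_spread K B P' (- K + int p) (- K + int k) / (real N * \<mu>))
      = 1 / real N" for P' p
    unfolding sum_divide_distrib[symmetric] sum_shift_int end_eq
    using block_spread_row_total[of K B P'] K \<mu>0 by (simp add: \<mu>[symmetric])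
  note transposed = block_spread_transpose[of K B P "- K + int i" "- K + int j" for i j]
  show ?thesis
  proof (rule quasi_copula_mass_distributionI)
    show "(\<Sum>i\<in>{1..p}. block_spread K B P (- K + int i) (- K + int q) / (real N * \<mu>))
        \<in> {0..1 / real N}" if "q \<in> {1..N}" "p \<le> N" for p q
      unfolding transposed by (rule prefix) (use that bound in auto)
    show "(\<Sum>i\<in>{1..N}. block_spread K B P (- K + int i) (- K + int q) / (real N * \<mu>))
        = 1 / real N" for q
      unfolding transposed by (rule total)
  qed (use N0 prefix total bound in auto)
qed

section \<open>The big square and its small squares\<close>

lemma big_square_eq_Union_small_squares:
  assumes "hm < hp" "vm < vp"
  shows "big_square hm hp vm vp = (\<Union>i\<in>{hm+1..hp}. \<Union>j\<in>{vm+1..vp}. small_square i j)"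
proof -
  \<comment> \<open>The maximum matters only at the left end, where the ceiling is \<open>a\<close> itself.\<close>
  have cover: "\<exists>i\<in>{a+1..b}. real_of_int i - 1 \<le> x \<and> x \<le> real_of_int i"
    if "a < b" "real_of_int a \<le> x" "x \<le> real_of_int b" for a b :: int and x :: real
  proof (intro bexI[of _ "max (a + 1) \<lceil>x\<rceil>"] conjI)
    show "real_of_int (max (a + 1) \<lceil>x\<rceil>) - 1 \<le> x" "x \<le> real_of_int (max (a + 1) \<lceil>x\<rceil>)"
      using that by linarith+
    show "max (a + 1) \<lceil>x\<rceil> \<in> {a+1..b}"
      using that by (auto simp: ceiling_le_iff)
  qed
  show ?thesis
  proof (intro equalityI subsetI)
    fix z assume "z \<in> big_square hm hp vm vp"
    then obtain x y where z: "z = (x, y)"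
      and "real_of_int hm \<le> x" "x \<le> real_of_int hp" "real_of_int vm \<le> y" "y \<le> real_of_int vp"
      by (auto simp: big_square_def)
    moreover from this obtain i
      where "i \<in> {hm+1..hp}" "real_of_int i - 1 \<le> x" "x \<le> real_of_int i"
      using cover[OF assms(1)] by blast
    moreover from calculation obtain j
      where "j \<in> {vm+1..vp}" "real_of_int j - 1 \<le> y" "y \<le> real_of_int j"
      using cover[OF assms(2)] by blast
    ultimately show "z \<in> (\<Union>i\<in>{hm+1..hp}. \<Union>j\<in>{vm+1..vp}. small_square i j)"
      unfolding z small_square_def by (intro UN_I[of i] UN_I[of j]) auto
  qed (auto simp: big_square_def small_square_def)
qed

lemma card_small_squares:
  assumes "hp - hm = int N" "vp - vm = int N"
  shows "card {small_square i j | i j. i \<in> {hm+1..hp} \<and> j \<in> {vm+1..vp}} = N ^ 2"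
proof -
  have "inj_on (\<lambda>(i, j). small_square i j) ({hm+1..hp} \<times> {vm+1..vp})"
    by (auto simp: inj_on_def small_square_def times_eq_iff)
  moreover have "{small_square i j | i j. i \<in> {hm+1..hp} \<and> j \<in> {vm+1..vp}}
      = (\<lambda>(i, j). small_square i j) ` ({hm+1..hp} \<times> {vm+1..vp})"
    by (force simp only: image_iff Bex_def mem_Sigma_iff split_paired_Ex prod.case)
  moreover have "nat (hp - hm) = N" "nat (vp - vm) = N" using assms by auto
  ultimately show ?thesis
    by (simp add: card_image card_cartesian_product power2_eq_square)
qed

section \<open>Embedding a signed mass pattern\<close>

theorem theorem23:
  fixes m n :: int
    and P :: "int \<Rightarrow> int \<Rightarrow> real"
  assumes "m \<ge> 1" and "n \<ge> 1"
  shows "\<exists>(hm :: int) (vm :: int) (hp :: int) (vp :: int) (N :: nat)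
            (V :: int \<Rightarrow> int \<Rightarrow> real) (\<mu> :: real).
      hm \<le> 0 \<and> vm \<le> 0 \<and> hp \<ge> m \<and> vp \<ge> n \<and>
      hp - hm = int N \<and> vp - vm = int N \<and>
      big_square hm hp vm vp = (\<Union>i\<in>{hm+1..hp}. \<Union>j\<in>{vm+1..vp}. small_square i j) \<and>
      card {small_square i j | i j. i \<in> {hm+1..hp} \<and> j \<in> {vm+1..vp}} = N ^ 2 \<and>
      (\<forall>i\<in>{hm+1..hp}. (\<Sum>k\<in>{vm+1..vp}. V i k) = \<mu>) \<and>
      (\<forall>j\<in>{vm+1..vp}. (\<Sum>k\<in>{hm+1..hp}. V k j) = \<mu>) \<and>
      (\<forall>i\<in>{1..m}. \<forall>j\<in>{1..n}. V i j = P i j) \<and>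
      \<mu> \<noteq> 0 \<and>
      quasi_copula_mass_distribution N
        (\<lambda>p q. V (hm + int p) (vm + int q) / (real N * \<mu>))"
proof -
  define K where "K = max m n"
  \<comment> \<open>Adding 1 makes the bound, and with it \<open>\<mu>\<close>, positive even when \<open>P\<close> vanishes.\<close>
  define B where "B = 1 + (\<Sum>(i, j)\<in>{1..K} \<times> {1..K}. \<bar>P i j\<bar>)"
  define V where "V = block_spread K B P"
  define N where "N = nat (3 * K)"
  define \<mu> where "\<mu> = 3 * real_of_int K * B"
  have K: "1 \<le> K" "m \<le> K" "n \<le> K" using assms by (auto simp: K_def)
  have N: "int N = 3 * K" using K by (simp add: N_def)
  have B: "0 < B" unfolding B_def by (intro add_pos_nonneg sum_nonneg) auto
  have bound: "\<bar>P i j\<bar> \<le> B" if "i \<in> {1..K}" "j \<in> {1..K}" for i j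
  proof -
    have "(\<lambda>(i, j). \<bar>P i j\<bar>) (i, j) \<le> (\<Sum>(i, j)\<in>{1..K} \<times> {1..K}. \<bar>P i j\<bar>)"
      by (rule member_le_sum) (use that in auto)
    then show ?thesis by (simp add: B_def)
  qed
  have row: "(\<Sum>k\<in>{-K+1..2*K}. V i k) = \<mu>" for i
    using K unfolding V_def \<mu>_def by (intro block_spread_row_total) simp
  have col: "(\<Sum>k\<in>{-K+1..2*K}. V k j) = \<mu>" for j
    using K unfolding V_def \<mu>_def block_spread_transpose[of K B P _ j]
    by (intro block_spread_row_total) simp
  have patch: "V i j = P i j" if "i \<in> {1..m}" "j \<in> {1..n}" for i j
    using that K by (simp add: V_def block_spread_def)
  have mass: "quasi_copula_mass_distribution N
      (\<lambda>p q. V (- K + int p) (- K + int q) / (real N * \<mu>))"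
    unfolding V_def using block_spread_mass_distribution[OF K(1) B bound N \<mu>_def] .
  have \<mu>: "\<mu> \<noteq> 0" using K B by (simp add: \<mu>_def)
  have big: "big_square (-K) (2*K) (-K) (2*K)
      = (\<Union>i\<in>{-K+1..2*K}. \<Union>j\<in>{-K+1..2*K}. small_square i j)"
    using K by (intro big_square_eq_Union_small_squares) auto
  have num: "card {small_square i j | i j. i \<in> {-K+1..2*K} \<and> j \<in> {-K+1..2*K}} = N ^ 2"
    using N by (intro card_small_squares) auto
  show ?thesis
    by (rule exI[of _ "-K"], rule exI[of _ "-K"], rule exI[of _ "2*K"], rule exI[of _ "2*K"],
        rule exI[of _ N], rule exI[of _ V], rule exI[of _ \<mu>], intro conjI ballI)
      (use K N row col patch \<mu> mass big num in auto)
qed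

end
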